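(* Let $\kappa$ be a field, $G$ a group, $\sigma$ a $\kappa$-valued twist of a unital partial action $\theta=\{\theta_g:D_{g^{-1}}\to D_g\}_{g\in G}$ of $G$ on a $\kappa$-algebra $A$, and let $(\pi,\Gamma)$ be a covariant $\sigma$-representation of $\theta$ in a unital $\kappa$-algebra $R$. Then the map $\pi\times\Gamma:A\ast_{\theta,\sigma}G\to R$ determined by $$a\delta_g\mapsto\pi(a)\Gamma(g),\qquad g\in G,\ a\in D_g,$$ is a homomorphism of $\kappa$-algebras.
   Context: Unital partial action of $G$ on a unital $\kappa$-algebra $A$: a family of $\kappa$-algebra isomorphisms $\theta_g:D_{g^{-1}}\to D_g$ ($g\in G$), where $D_g$ is an ideal of $A$ generated by a central idempotent $1_g$ of $A$ ($D_g=0$ allowed), such that $D_1=A$, $\theta_1=\mathrm{id}_A$, $\theta_g(D_{g^{-1}}D_h)=D_gD_{gh}$, and $\theta_g\theta_h(a)=\theta_{gh}(a)$ for $a\in D_{h^{-1}}D_{(gh)^{-1}}$. A $\kappa$-valued twist of $\theta$ is a function $\sigma:G\times G\to\kappa$ with $\sigma(g,h)=0\iff 1_g1_{gh}=0$ such that $\varsigma_{g,h}:=\sigma(g,h)1_g1_{gh}$ satisfies $\varsigma_{1,g}=\varsigma_{g,1}=1_g$ and $\theta_g(1_{g^{-1}}\varsigma_{h,t})\varsigma_{g,ht}=\varsigma_{g,h}\varsigma_{gh,t}$ for all $g,h,t\in G$. The crossed product is $A\ast_{\theta,\sigma}G=\bigoplus_{g\in G}D_g\delta_g$ with multiplication $(a_g\delta_g)(b_h\delta_h)=\sigma(g,h)\,a_g\theta_g(1_{g^{-1}}b_h)\,\delta_{gh}$.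 A partial $\sigma$-representation of $G$ in $R$ is a map $\Gamma:G\to R$ such that for all $g,h\in G$: $\sigma(g,h)=0$ implies $\Gamma(g^{-1})\Gamma(gh)=0$ and $\Gamma(gh)\Gamma(h^{-1})=0$; $\Gamma(g^{-1})\Gamma(g)\Gamma(h)=\sigma(g,h)\Gamma(g^{-1})\Gamma(gh)$; $\Gamma(g)\Gamma(h)\Gamma(h^{-1})=\sigma(g,h)\Gamma(gh)\Gamma(h^{-1})$; $\Gamma(1_G)=1_R$. A covariant $\sigma$-representation of $\theta$ in $R$ is a pair $(\pi,\Gamma)$ where $\pi:A\to R$ is a homomorphism of $\kappa$-algebras (linear and multiplicative) and $\Gamma:G\to R$ is a partial $\sigma$-representation such that $\Gamma(g)\pi(a)\Gamma(g^{-1})=\sigma(g,g^{-1})\pi(\theta_g(a))$ for all $g\in G$, $a\in D_{g^{-1}}$. Here "homomorphism of $\kappa$-algebras" means $\kappa$-linear and multiplicative. *)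

theory Defs
  imports "HOL-Algebra.Module" "HOL-Algebra.Ideal_Product" "HOL-Algebra.Product_Groups"
begin

text \<open>
  The library locale \<^locale>\<open>algebra\<close> is restricted to commutative algebras. As everywhere in
  HOL-Algebra, \<^locale>\<open>ring\<close> means unital associative ring, and the zero ring is allowed.
\<close>

locale unital_algebra = module K A + ring A for K (structure) and A (structure) +
  assumes smult_mult_left:
      "\<lbrakk>k \<in> carrier K; x \<in> carrier A; y \<in> carrier A\<rbrakk> \<Longrightarrow>
        (k \<odot>\<^bsub>A\<^esub> x) \<otimes>\<^bsub>A\<^esub> y = k \<odot>\<^bsub>A\<^esub> (x \<otimes>\<^bsub>A\<^esub> y)"
    and smult_mult_right:
      "\<lbrakk>k \<in> carrier K; x \<in> carrier A; y \<in> carrier A\<rbrakk> \<Longrightarrow>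
        x \<otimes>\<^bsub>A\<^esub> (k \<odot>\<^bsub>A\<^esub> y) = k \<odot>\<^bsub>A\<^esub> (x \<otimes>\<^bsub>A\<^esub> y)"

definition lin_map ::
  "('k, 'm) ring_scheme \<Rightarrow> ('k, 'a, 'p) module_scheme \<Rightarrow> ('k, 'b, 'q) module_scheme \<Rightarrow> ('a \<Rightarrow> 'b) set"
  where "lin_map K A B =
    {h \<in> carrier A \<rightarrow> carrier B.
      (\<forall>x\<in>carrier A. \<forall>y\<in>carrier A. h (x \<oplus>\<^bsub>A\<^esub> y) = h x \<oplus>\<^bsub>B\<^esub> h y) \<and>
      (\<forall>k\<in>carrier K. \<forall>x\<in>carrier A. h (k \<odot>\<^bsub>A\<^esub> x) = k \<odot>\<^bsub>B\<^esub> h x)}"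

text \<open>Homomorphisms are linear and multiplicative, but need not preserve the unit; hence
  \<^const>\<open>ring_hom\<close> is not used.\<close>

definition alg_hom ::
  "('k, 'm) ring_scheme \<Rightarrow> ('k, 'a, 'p) module_scheme \<Rightarrow> ('k, 'b, 'q) module_scheme \<Rightarrow> ('a \<Rightarrow> 'b) set"
  where "alg_hom K A B =
    {h \<in> lin_map K A B.
      \<forall>x\<in>carrier A. \<forall>y\<in>carrier A. h (x \<otimes>\<^bsub>A\<^esub> y) = h x \<otimes>\<^bsub>B\<^esub> h y}"

definition alg_iso ::
  "('k, 'm) ring_scheme \<Rightarrow> ('k, 'a, 'p) module_scheme \<Rightarrow> ('k, 'b, 'q) module_scheme \<Rightarrow> ('a \<Rightarrow> 'b) set"
  where "alg_iso K A B = {h \<in> alg_hom K A B. bij_betw h (carrier A) (carrier B)}"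

text \<open>
  \<open>u g\<close> is the central idempotent written $1_g$; being the identity element of \<open>D g\<close>, it is
  determined by \<open>D\<close>. Only the values of \<open>\<theta> g\<close> on \<open>D (inv g)\<close> matter. The dot is the library's
  product of ideals \<^const>\<open>ideal_prod\<close>.
\<close>

locale unital_partial_action =
  K?: field K + G?: group G + A?: unital_algebra K A
  for K :: "('k, 'm) ring_scheme" (structure)
    and G :: "('g, 'n) monoid_scheme" (structure)
    and A :: "('k, 'a, 'p) module_scheme" (structure)
    and D :: "'g \<Rightarrow> 'a set"
    and u :: "'g \<Rightarrow> 'a"
    and \<theta> :: "'g \<Rightarrow> 'a \<Rightarrow> 'a" +
  assumes u_closed: "g \<in> carrier G \<Longrightarrow> u g \<in> carrier A"
    and u_idem: "g \<in> carrier G \<Longrightarrow> u g \<otimes>\<^bsub>A\<^esub> u g = u g"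
    and u_central: "\<lbrakk>g \<in> carrier G; a \<in> carrier A\<rbrakk> \<Longrightarrow> u g \<otimes>\<^bsub>A\<^esub> a = a \<otimes>\<^bsub>A\<^esub> u g"
    and D_eq: "g \<in> carrier G \<Longrightarrow> D g = Idl\<^bsub>A\<^esub> {u g}"
    and theta_iso:
      "g \<in> carrier G \<Longrightarrow> \<theta> g \<in> alg_iso K (A\<lparr>carrier := D (inv\<^bsub>G\<^esub> g)\<rparr>) (A\<lparr>carrier := D g\<rparr>)"
    and D_one: "D \<one>\<^bsub>G\<^esub> = carrier A"
    and theta_one: "a \<in> carrier A \<Longrightarrow> \<theta> \<one>\<^bsub>G\<^esub> a = a"
    and theta_image:
      "\<lbrakk>g \<in> carrier G; h \<in> carrier G\<rbrakk> \<Longrightarrow>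
        \<theta> g ` (D (inv\<^bsub>G\<^esub> g) \<cdot>\<^bsub>A\<^esub> D h) = D g \<cdot>\<^bsub>A\<^esub> D (g \<otimes>\<^bsub>G\<^esub> h)"
    and theta_comp:
      "\<lbrakk>g \<in> carrier G; h \<in> carrier G; a \<in> D (inv\<^bsub>G\<^esub> h) \<cdot>\<^bsub>A\<^esub> D (inv\<^bsub>G\<^esub> (g \<otimes>\<^bsub>G\<^esub> h))\<rbrakk> \<Longrightarrow>
        \<theta> g (\<theta> h a) = \<theta> (g \<otimes>\<^bsub>G\<^esub> h) a"

definition twist_elem ::
  "('g, 'n) monoid_scheme \<Rightarrow> ('k, 'a, 'p) module_scheme \<Rightarrow> ('g \<Rightarrow> 'a) \<Rightarrow> ('g \<Rightarrow> 'g \<Rightarrow> 'k)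
    \<Rightarrow> 'g \<Rightarrow> 'g \<Rightarrow> 'a"
  where "twist_elem G A u \<sigma> g h = \<sigma> g h \<odot>\<^bsub>A\<^esub> (u g \<otimes>\<^bsub>A\<^esub> u (g \<otimes>\<^bsub>G\<^esub> h))"

locale twisted_unital_partial_action = unital_partial_action K G A D u \<theta>
  for K :: "('k, 'm) ring_scheme" (structure)
    and G :: "('g, 'n) monoid_scheme" (structure)
    and A :: "('k, 'a, 'p) module_scheme" (structure)
    and D u \<theta>
    and \<sigma> :: "'g \<Rightarrow> 'g \<Rightarrow> 'k" +
  assumes twist_closed: "\<lbrakk>g \<in> carrier G; h \<in> carrier G\<rbrakk> \<Longrightarrow> \<sigma> g h \<in> carrier K"
    and twist_zero_iff:
      "\<lbrakk>g \<in> carrier G; h \<in> carrier G\<rbrakk> \<Longrightarrow>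
        \<sigma> g h = \<zero>\<^bsub>K\<^esub> \<longleftrightarrow> u g \<otimes>\<^bsub>A\<^esub> u (g \<otimes>\<^bsub>G\<^esub> h) = \<zero>\<^bsub>A\<^esub>"
    and twist_one_left: "g \<in> carrier G \<Longrightarrow> twist_elem G A u \<sigma> \<one>\<^bsub>G\<^esub> g = u g"
    and twist_one_right: "g \<in> carrier G \<Longrightarrow> twist_elem G A u \<sigma> g \<one>\<^bsub>G\<^esub> = u g"
    and twist_cocycle:
      "\<lbrakk>g \<in> carrier G; h \<in> carrier G; t \<in> carrier G\<rbrakk> \<Longrightarrow>
        \<theta> g (u (inv\<^bsub>G\<^esub> g) \<otimes>\<^bsub>A\<^esub> twist_elem G A u \<sigma> h t)
            \<otimes>\<^bsub>A\<^esub> twist_elem G A u \<sigma> g (h \<otimes>\<^bsub>G\<^esub> t)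
          = twist_elem G A u \<sigma> g h \<otimes>\<^bsub>A\<^esub> twist_elem G A u \<sigma> (g \<otimes>\<^bsub>G\<^esub> h) t"

text \<open>
  An element $\sum_g a_g \delta_g$ of the crossed product is the finitely supported family
  $(a_g)_{g \in G}$ with $a_g \in D_g$, extended by \<^const>\<open>undefined\<close> off the carrier of \<open>G\<close> (the
  convention of \<^const>\<open>sum_group\<close>). The product is the bilinear extension of
  $(a_g\delta_g)(b_h\delta_h) = \sigma(g,h) a_g \theta_g(1_{g^{-1}} b_h)\delta_{gh}$.
\<close>

definition supp ::
  "('g, 'n) monoid_scheme \<Rightarrow> ('k, 'a, 'p) module_scheme \<Rightarrow> ('g \<Rightarrow> 'a) \<Rightarrow> 'g set"
  where "supp G A f = {g \<in> carrier G. f g \<noteq> \<zero>\<^bsub>A\<^esub>}"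

definition delta ::
  "('g, 'n) monoid_scheme \<Rightarrow> ('k, 'a, 'p) module_scheme \<Rightarrow> 'a \<Rightarrow> 'g \<Rightarrow> ('g \<Rightarrow> 'a)"
  where "delta G A a g = (\<lambda>x\<in>carrier G. if x = g then a else \<zero>\<^bsub>A\<^esub>)"

definition crossed_product ::
  "('g, 'n) monoid_scheme \<Rightarrow> ('k, 'a, 'p) module_scheme \<Rightarrow> ('g \<Rightarrow> 'a set) \<Rightarrow> ('g \<Rightarrow> 'a)
    \<Rightarrow> ('g \<Rightarrow> 'a \<Rightarrow> 'a) \<Rightarrow> ('g \<Rightarrow> 'g \<Rightarrow> 'k) \<Rightarrow> ('k, 'g \<Rightarrow> 'a) module"
  where "crossed_product G A D u \<theta> \<sigma> =
    \<lparr>carrier = {f \<in> (\<Pi>\<^sub>E g\<in>carrier G. D g). finite (supp G A f)},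
     monoid.mult = (\<lambda>f f'. \<lambda>x\<in>carrier G.
       \<Oplus>\<^bsub>A\<^esub>p\<in>{p \<in> supp G A f \<times> supp G A f'. fst p \<otimes>\<^bsub>G\<^esub> snd p = x}.
         \<sigma> (fst p) (snd p) \<odot>\<^bsub>A\<^esub>
           (f (fst p) \<otimes>\<^bsub>A\<^esub> \<theta> (fst p) (u (inv\<^bsub>G\<^esub> (fst p)) \<otimes>\<^bsub>A\<^esub> f' (snd p)))),
     one = delta G A \<one>\<^bsub>A\<^esub> \<one>\<^bsub>G\<^esub>,
     ring.zero = (\<lambda>x\<in>carrier G. \<zero>\<^bsub>A\<^esub>),
     ring.add = (\<lambda>f f'. \<lambda>x\<in>carrier G. f x \<oplus>\<^bsub>A\<^esub> f' x),
     smult = (\<lambda>k f. \<lambda>x\<in>carrier G. k \<odot>\<^bsub>A\<^esub> f x)\<rparr>"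

definition partial_sigma_rep ::
  "('g, 'n) monoid_scheme \<Rightarrow> ('k, 'm) ring_scheme \<Rightarrow> ('k, 'r, 'q) module_scheme
    \<Rightarrow> ('g \<Rightarrow> 'g \<Rightarrow> 'k) \<Rightarrow> ('g \<Rightarrow> 'r) \<Rightarrow> bool"
  where "partial_sigma_rep G K R \<sigma> \<Gamma> \<longleftrightarrow>
    \<Gamma> \<in> carrier G \<rightarrow> carrier R \<and>
    (\<forall>g\<in>carrier G. \<forall>h\<in>carrier G.
      (\<sigma> g h = \<zero>\<^bsub>K\<^esub> \<longrightarrow>
        \<Gamma> (inv\<^bsub>G\<^esub> g) \<otimes>\<^bsub>R\<^esub> \<Gamma> (g \<otimes>\<^bsub>G\<^esub> h) = \<zero>\<^bsub>R\<^esub> \<and>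
        \<Gamma> (g \<otimes>\<^bsub>G\<^esub> h) \<otimes>\<^bsub>R\<^esub> \<Gamma> (inv\<^bsub>G\<^esub> h) = \<zero>\<^bsub>R\<^esub>) \<and>
      \<Gamma> (inv\<^bsub>G\<^esub> g) \<otimes>\<^bsub>R\<^esub> \<Gamma> g \<otimes>\<^bsub>R\<^esub> \<Gamma> h
        = \<sigma> g h \<odot>\<^bsub>R\<^esub> (\<Gamma> (inv\<^bsub>G\<^esub> g) \<otimes>\<^bsub>R\<^esub> \<Gamma> (g \<otimes>\<^bsub>G\<^esub> h)) \<and>
      \<Gamma> g \<otimes>\<^bsub>R\<^esub> \<Gamma> h \<otimes>\<^bsub>R\<^esub> \<Gamma> (inv\<^bsub>G\<^esub> h)
        = \<sigma> g h \<odot>\<^bsub>R\<^esub> (\<Gamma> (g \<otimes>\<^bsub>G\<^esub> h) \<otimes>\<^bsub>R\<^esub> \<Gamma> (inv\<^bsub>G\<^esub> h))) \<and>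
    \<Gamma> \<one>\<^bsub>G\<^esub> = \<one>\<^bsub>R\<^esub>"

definition covariant_sigma_rep ::
  "('k, 'm) ring_scheme \<Rightarrow> ('g, 'n) monoid_scheme \<Rightarrow> ('k, 'a, 'p) module_scheme
    \<Rightarrow> ('g \<Rightarrow> 'a set) \<Rightarrow> ('g \<Rightarrow> 'a \<Rightarrow> 'a) \<Rightarrow> ('g \<Rightarrow> 'g \<Rightarrow> 'k) \<Rightarrow> ('k, 'r, 'q) module_scheme
    \<Rightarrow> ('a \<Rightarrow> 'r) \<Rightarrow> ('g \<Rightarrow> 'r) \<Rightarrow> bool"
  where "covariant_sigma_rep K G A D \<theta> \<sigma> R \<pi> \<Gamma> \<longleftrightarrow>
    \<pi> \<in> alg_hom K A R \<and>
    partial_sigma_rep G K R \<sigma> \<Gamma> \<and>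
    (\<forall>g\<in>carrier G. \<forall>a\<in>D (inv\<^bsub>G\<^esub> g).
      \<Gamma> g \<otimes>\<^bsub>R\<^esub> \<pi> a \<otimes>\<^bsub>R\<^esub> \<Gamma> (inv\<^bsub>G\<^esub> g) = \<sigma> g (inv\<^bsub>G\<^esub> g) \<odot>\<^bsub>R\<^esub> \<pi> (\<theta> g a))"

text \<open>The map $\pi \times \Gamma$ sending $\sum_g a_g\delta_g$ to $\sum_g \pi(a_g)\Gamma(g)$.\<close>

definition integrated_map ::
  "('g, 'n) monoid_scheme \<Rightarrow> ('k, 'a, 'p) module_scheme \<Rightarrow> ('k, 'r, 'q) module_scheme
    \<Rightarrow> ('a \<Rightarrow> 'r) \<Rightarrow> ('g \<Rightarrow> 'r) \<Rightarrow> ('g \<Rightarrow> 'a) \<Rightarrow> 'r"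
  where "integrated_map G A R \<pi> \<Gamma> f = (\<Oplus>\<^bsub>R\<^esub>g\<in>supp G A f. \<pi> (f g) \<otimes>\<^bsub>R\<^esub> \<Gamma> g)"

text \<open>The record above has the multiplication on homogeneous elements that it should have.\<close>

context unital_partial_action
begin

lemma ideal_D: "g \<in> carrier G \<Longrightarrow> ideal (D g) A"
  using D_eq u_closed A.genideal_ideal by simp

lemma zero_in_D: "g \<in> carrier G \<Longrightarrow> \<zero>\<^bsub>A\<^esub> \<in> D g"
  using ideal_D by (simp add: additive_subgroup.zero_closed ideal.axioms(1))

lemma D_carrier: "\<lbrakk>g \<in> carrier G; a \<in> D g\<rbrakk> \<Longrightarrow> a \<in> carrier A"
  using ideal_D by (meson ideal.Icarr)

lemma u_in_D: "g \<in> carrier G \<Longrightarrow> u g \<in> D g"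
  using D_eq u_closed A.genideal_self' by simp

lemma theta_closed: "\<lbrakk>g \<in> carrier G; a \<in> D (inv\<^bsub>G\<^esub> g)\<rbrakk> \<Longrightarrow> \<theta> g a \<in> D g"
  using theta_iso[of g] by (auto simp: alg_iso_def alg_hom_def lin_map_def)

lemma theta_zero:
  assumes g: "g \<in> carrier G" shows "\<theta> g \<zero>\<^bsub>A\<^esub> = \<zero>\<^bsub>A\<^esub>"
proof -
  have z: "\<zero>\<^bsub>A\<^esub> \<in> D (inv\<^bsub>G\<^esub> g)" using g zero_in_D by simp
  then have c: "\<theta> g \<zero>\<^bsub>A\<^esub> \<in> carrier A" using g theta_closed D_carrier by blast
  have "\<theta> g (\<zero>\<^bsub>A\<^esub> \<oplus>\<^bsub>A\<^esub> \<zero>\<^bsub>A\<^esub>) = \<theta> g \<zero>\<^bsub>A\<^esub> \<oplus>\<^bsub>A\<^esub> \<theta> g \<zero>\<^bsub>A\<^esub>"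
    using theta_iso[OF g] z
    unfolding alg_iso_def alg_hom_def lin_map_def by fastforce
  moreover have "group (add_monoid A)" using abelian_group.a_group[of A] by unfold_locales
  ultimately show ?thesis
    using c group.l_cancel_one[of "add_monoid A" "\<theta> g \<zero>\<^bsub>A\<^esub>" "\<theta> g \<zero>\<^bsub>A\<^esub>"]
      M.zero_closed M.l_zero by simp
qed

lemma supp_delta:
  "g \<in> carrier G \<Longrightarrow> supp G A (delta G A a g) = (if a = \<zero>\<^bsub>A\<^esub> then {} else {g})"
  by (auto simp: supp_def delta_def)

lemma delta_closed:
  "\<lbrakk>g \<in> carrier G; a \<in> D g\<rbrakk> \<Longrightarrow> delta G A a g \<in> carrier (crossed_product G A D u \<theta> \<sigma>)"
  using zero_in_D by (auto simp: crossed_product_def supp_delta, auto simp: delta_def)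

end

lemma (in twisted_unital_partial_action) crossed_product_mult_delta:
  assumes g: "g \<in> carrier G" and h: "h \<in> carrier G" and a: "a \<in> D g" and b: "b \<in> D h"
  shows "delta G A a g \<otimes>\<^bsub>crossed_product G A D u \<theta> \<sigma>\<^esub> delta G A b h
    = delta G A (\<sigma> g h \<odot>\<^bsub>A\<^esub> (a \<otimes>\<^bsub>A\<^esub> \<theta> g (u (inv\<^bsub>G\<^esub> g) \<otimes>\<^bsub>A\<^esub> b))) (g \<otimes>\<^bsub>G\<^esub> h)"
proof -
  have ac: "a \<in> carrier A" and bc: "b \<in> carrier A" using assms D_carrier by auto
  have "u (inv\<^bsub>G\<^esub> g) \<otimes>\<^bsub>A\<^esub> b \<in> D (inv\<^bsub>G\<^esub> g)"
    using g bc u_in_D ideal_D by (simp add: ideal.I_r_closed)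
  then have tc: "\<theta> g (u (inv\<^bsub>G\<^esub> g) \<otimes>\<^bsub>A\<^esub> b) \<in> carrier A"
    using g theta_closed D_carrier by blast
  have ig: "u (inv\<^bsub>G\<^esub> g) \<in> carrier A" using g u_closed by simp
  have z: "\<sigma> g h \<odot>\<^bsub>A\<^esub> \<zero>\<^bsub>A\<^esub> = \<zero>\<^bsub>A\<^esub>" using twist_closed[OF g h] by simp
  show ?thesis
  proof (cases "a = \<zero>\<^bsub>A\<^esub> \<or> b = \<zero>\<^bsub>A\<^esub>")
    case True
    then have "\<sigma> g h \<odot>\<^bsub>A\<^esub> (a \<otimes>\<^bsub>A\<^esub> \<theta> g (u (inv\<^bsub>G\<^esub> g) \<otimes>\<^bsub>A\<^esub> b)) = \<zero>\<^bsub>A\<^esub>"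
      using z tc ac ig theta_zero[OF g] by auto
    with True g h show ?thesis
      by (auto simp: crossed_product_def supp_delta) (auto simp: delta_def)
  next
    case False
    have s: "{p. p = (g, h) \<and> fst p \<otimes>\<^bsub>G\<^esub> snd p = x}
        = (if x = g \<otimes>\<^bsub>G\<^esub> h then {(g, h)} else {})" for x
      by auto
    have c: "\<sigma> g h \<odot>\<^bsub>A\<^esub> (a \<otimes>\<^bsub>A\<^esub> \<theta> g (u (inv\<^bsub>G\<^esub> g) \<otimes>\<^bsub>A\<^esub> b)) \<in> carrier A"
      using twist_closed[OF g h] ac tc by simp
    show ?thesis
      using False g h c
      by (auto simp: crossed_product_def supp_delta restrict_def fun_eq_iff)
        (simp_all add: delta_def s)
  qed
qed

end

theory Submission
  imports Defs
begin

text \<open>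
  Linearity of $\pi \times \Gamma$ and its uniqueness are formal, as an element of the crossed product
  is a finite sum of homogeneous elements $a\delta_g$. The content is multiplicativity, which by
  bilinearity comes down to
  \[ \pi(a)\Gamma(g)\,\pi(b)\Gamma(h) = \sigma(g,h)\,\pi(a\,\theta_g(1_{g^{-1}}b))\,\Gamma(gh),
     \qquad a \in D_g,\ b \in D_h \]
  (lemma \<open>homogeneous_mult\<close>). If $1_g = 0$, then $a = 0$ and both sides vanish. Otherwise
  $s = \sigma(g,g^{-1})$ and $s' = \sigma(g^{-1},g)$ are nonzero scalars.

  The key fact (lemma \<open>range_projection_fixes_pi\<close>) is that $F = \Gamma(g)\Gamma(g^{-1})$ acts on
  $\pi(D_g)$ as the scalar $s$ from either side. Indeed
  $F^2 = sF$ by the axioms of a partial $\sigma$-representation, and applying covariance to $g^{-1}$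
  and then to $g$ gives $F\pi(a)F = s's\,\pi(a)$. Multiplying the latter by $F$ on one side and
  cancelling $s's$ gives the claim.

  Consequently $s\,\pi(a)\Gamma(g) = F\pi(a)\Gamma(g) = s'\,\Gamma(g)\pi(\theta_{g^{-1}}(a))$, so that
  $\pi(a)$ moves past $\Gamma(g)$. It meets $\pi(b)$ there and forms $\pi(c)$ with
  $c = \theta_{g^{-1}}(a)b \in D_{g^{-1}}$. As $s'\pi(c) = \pi(c)\Gamma(g^{-1})\Gamma(g)$, we get
  \[ s'\,\Gamma(g)\pi(c)\Gamma(h) = \Gamma(g)\pi(c)\,\Gamma(g^{-1})\Gamma(g)\Gamma(h)
     = \sigma(g,h)\,\Gamma(g)\pi(c)\Gamma(g^{-1})\,\Gamma(gh)
     = s\,\sigma(g,h)\,\pi(\theta_g(c))\Gamma(gh), \]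
  and $\theta_g(c) = a\,\theta_g(1_{g^{-1}}b)$. Cancelling $s$ proves the identity.
\<close>

section \<open>Finite sums and linear maps\<close>

lemma (in module) smult_left_cancel:
  assumes "field R" and "k \<in> carrier R" and "k \<noteq> \<zero>" and "x \<in> carrier M" and "y \<in> carrier M"
    and eq: "k \<odot>\<^bsub>M\<^esub> x = k \<odot>\<^bsub>M\<^esub> y"
  shows "x = y"
proof -
  interpret R: field R by fact
  have k: "k \<in> Units R" using assms(2,3) R.field_Units by simp
  then have "inv\<^bsub>R\<^esub> k \<odot>\<^bsub>M\<^esub> (k \<odot>\<^bsub>M\<^esub> z) = z" if "z \<in> carrier M" for z
    using that assms(2) smult_assoc1[of "inv\<^bsub>R\<^esub> k" k z] by simp
  then show ?thesis using assms(4,5) eq by metis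
qed

text \<open>
  The fibres of \<open>m\<close> partition \<open>P\<close>. In additive form this serves twice: for \<open>m = fst\<close> it yields
  products of sums, and for the multiplication of \<open>G\<close> it matches the coefficients of a product in the
  crossed product with the pairs of indices that contribute to them.
\<close>

lemma (in comm_monoid) finprod_fibres:
  assumes "finite P" and "finite S" and "m ` P \<subseteq> S" and "\<And>p. p \<in> P \<Longrightarrow> w p \<in> carrier G"
  shows "finprod G w P = finprod G (\<lambda>x. finprod G w {p \<in> P. m p = x}) S"
proof -
  have "P = (\<Union>x\<in>S. {p \<in> P. m p = x})" using assms(3) by auto
  moreover have "finprod G w (\<Union>x\<in>S. {p \<in> P. m p = x})
      = finprod G (\<lambda>x. finprod G w {p \<in> P. m p = x}) S"
    by (rule finprod_UN_disjoint) (use assms in \<open>auto simp: pairwise_def disjnt_def\<close>)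
  ultimately show ?thesis by simp
qed

lemma (in ring) finsum_mult_finsum:
  assumes B: "finite B" and C: "finite C" and v: "v \<in> B \<rightarrow> carrier R" and w: "w \<in> C \<rightarrow> carrier R"
  shows "finsum R v B \<otimes> finsum R w C = finsum R (\<lambda>p. v (fst p) \<otimes> w (snd p)) (B \<times> C)"
proof -
  let ?t = "\<lambda>p. v (fst p) \<otimes> w (snd p)"
  have t: "?t p \<in> carrier R" if "p \<in> B \<times> C" for p
    using that v w by (auto simp: Pi_iff)
  have "finsum R ?t (B \<times> C) = finsum R (\<lambda>x. finsum R ?t {p \<in> B \<times> C. fst p = x}) B"
    by (rule add.finprod_fibres) (use B C t in auto)
  also have "\<dots> = finsum R (\<lambda>x. v x \<otimes> finsum R w C) B"
  proof (rule finsum_cong')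
    fix x assume x: "x \<in> B"
    have "{p \<in> B \<times> C. fst p = x} = Pair x ` C" using x by auto
    then have "finsum R ?t {p \<in> B \<times> C. fst p = x} = finsum R (\<lambda>y. ?t (x, y)) C"
      using x t finsum_reindex[of ?t "Pair x" C] by (auto simp: inj_on_def)
    also have "\<dots> = v x \<otimes> finsum R w C"
      using finsum_rdistr[OF C, of "v x" w] x v w by (auto simp: Pi_iff)
    finally show "finsum R ?t {p \<in> B \<times> C. fst p = x} = v x \<otimes> finsum R w C" .
  qed (use B C v w in auto)
  also have "\<dots> = finsum R v B \<otimes> finsum R w C"
    using finsum_ldistr[OF B, of "finsum R w C" v] C v w by auto
  finally show ?thesis by simp
qed

lemma lin_map_finsum:
  assumes "module K A" and "module K B" and h: "h \<in> lin_map K A B"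
    and S: "finite S" and w: "w \<in> S \<rightarrow> carrier A"
  shows "h (finsum A w S) = finsum B (\<lambda>i. h (w i)) S"
proof -
  interpret A: module K A by fact
  interpret B: module K B by fact
  have hc: "h \<in> carrier A \<rightarrow> carrier B"
    and ha: "\<And>x y. \<lbrakk>x \<in> carrier A; y \<in> carrier A\<rbrakk> \<Longrightarrow> h (x \<oplus>\<^bsub>A\<^esub> y) = h x \<oplus>\<^bsub>B\<^esub> h y"
    and hs: "\<And>k x. \<lbrakk>k \<in> carrier K; x \<in> carrier A\<rbrakk> \<Longrightarrow> h (k \<odot>\<^bsub>A\<^esub> x) = k \<odot>\<^bsub>B\<^esub> h x"
    using h by (auto simp: lin_map_def)
  \<comment> \<open>\<open>h\<close> preserves zero because \<open>\<zero>\<^bsub>A\<^esub>\<close> is the zero scalar times itself\<close>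
  have h0: "h \<zero>\<^bsub>A\<^esub> = \<zero>\<^bsub>B\<^esub>"
    using hs[of "\<zero>\<^bsub>K\<^esub>" "\<zero>\<^bsub>A\<^esub>"] hc B.smult_l_null[of "h \<zero>\<^bsub>A\<^esub>"] by auto
  show ?thesis
    using S w
  proof (induction S rule: finite_induct)
    case (insert i S)
    then have "w i \<in> carrier A" "w \<in> S \<rightarrow> carrier A" by auto
    moreover have "(\<lambda>i. h (w i)) \<in> S \<rightarrow> carrier B" "h (w i) \<in> carrier B" using calculation hc by auto
    ultimately show ?case using insert.hyps insert.IH ha by (simp add: A.M.finsum_closed)
  qed (simp add: h0)
qed

section \<open>Unital partial actions\<close>

context unital_partial_action
begin

text \<open>
  The elements fixed by multiplication with the central idempotent $1_g$ form an ideal containing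
  $1_g$, hence containing $D_g$.
\<close>

lemma u_mult_D:
  assumes g: "g \<in> carrier G" and a: "a \<in> D g"
  shows "u g \<otimes>\<^bsub>A\<^esub> a = a"
proof -
  let ?I = "{x \<in> carrier A. u g \<otimes>\<^bsub>A\<^esub> x = x}"
  have u: "u g \<in> carrier A" using g u_closed by simp
  have "ideal ?I A"
  proof (rule idealI[OF A.ring_axioms])
    show "subgroup ?I (add_monoid A)"
      by (rule A.M.add.subgroupI)
        (use u in \<open>auto simp: A.r_distr A.r_minus simp flip: a_inv_def\<close>)
  next
    fix a x assume "a \<in> ?I" "x \<in> carrier A"
    then show "x \<otimes>\<^bsub>A\<^esub> a \<in> ?I"
      using u u_central[OF g, of x] A.m_assoc[of "u g" x a] A.m_assoc[of x "u g" a] by simp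
    show "a \<otimes>\<^bsub>A\<^esub> x \<in> ?I"
      using u \<open>a \<in> ?I\<close> \<open>x \<in> carrier A\<close> A.m_assoc[of "u g" a x] by simp
  qed
  moreover have "{u g} \<subseteq> ?I" using u u_idem[OF g] by simp
  ultimately have "Idl\<^bsub>A\<^esub> {u g} \<subseteq> ?I" by (rule A.genideal_minimal)
  with a show ?thesis using D_eq[OF g] by auto
qed

lemma u_one: "u \<one>\<^bsub>G\<^esub> = \<one>\<^bsub>A\<^esub>"
  using u_mult_D[of "\<one>\<^bsub>G\<^esub>" "\<one>\<^bsub>A\<^esub>"] u_closed[of "\<one>\<^bsub>G\<^esub>"] D_one by simp

lemma theta_mult:
  assumes "g \<in> carrier G" and "a \<in> D (inv\<^bsub>G\<^esub> g)" and "b \<in> D (inv\<^bsub>G\<^esub> g)"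
  shows "\<theta> g (a \<otimes>\<^bsub>A\<^esub> b) = \<theta> g a \<otimes>\<^bsub>A\<^esub> \<theta> g b"
  using theta_iso[OF assms(1)] assms(2,3) by (simp add: alg_iso_def alg_hom_def)

text \<open>
  This is the composition law for the pair $(g, g^{-1})$; its domain $D_g D_1$ contains $a = a1$.
\<close>

lemma theta_theta_inv:
  assumes g: "g \<in> carrier G" and a: "a \<in> D g"
  shows "\<theta> g (\<theta> (inv\<^bsub>G\<^esub> g) a) = a"
proof -
  have ac: "a \<in> carrier A" using g a D_carrier by blast
  have "a \<otimes>\<^bsub>A\<^esub> \<one>\<^bsub>A\<^esub> \<in> D g \<cdot>\<^bsub>A\<^esub> carrier A"
    using a by (intro ideal_prod.prod) auto
  then show ?thesis
    using theta_comp[of g "inv\<^bsub>G\<^esub> g" a] g ac theta_one D_one by simp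
qed

text \<open>
  If $1_{g^{-1}} = 0$, then $D_{g^{-1}} = 0$, so $1_g = \theta_g(\theta_{g^{-1}}(1_g)) = \theta_g(0) = 0$.
\<close>

lemma u_inv_nonzero:
  assumes g: "g \<in> carrier G" and nz: "u g \<noteq> \<zero>\<^bsub>A\<^esub>"
  shows "u (inv\<^bsub>G\<^esub> g) \<noteq> \<zero>\<^bsub>A\<^esub>"
proof
  assume z: "u (inv\<^bsub>G\<^esub> g) = \<zero>\<^bsub>A\<^esub>"
  let ?b = "\<theta> (inv\<^bsub>G\<^esub> g) (u g)"
  have b: "?b \<in> D (inv\<^bsub>G\<^esub> g)" using theta_closed[of "inv\<^bsub>G\<^esub> g" "u g"] g u_in_D by simp
  have "?b \<in> carrier A" using b g D_carrier[of "inv\<^bsub>G\<^esub> g"] by simp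
  then have "?b = \<zero>\<^bsub>A\<^esub>" using u_mult_D[OF _ b] g z by simp
  then show False using theta_theta_inv[OF g u_in_D[OF g]] theta_zero[OF g] nz by simp
qed

end

text \<open>
  Here $1_g 1_{gg^{-1}} = 1_g$, as $1_1$ is the unit of the algebra.
\<close>

lemma (in twisted_unital_partial_action) twist_inv_nonzero:
  assumes g: "g \<in> carrier G" and nz: "u g \<noteq> \<zero>\<^bsub>A\<^esub>"
  shows "\<sigma> g (inv\<^bsub>G\<^esub> g) \<noteq> \<zero>\<^bsub>K\<^esub>"
  using twist_zero_iff[of g "inv\<^bsub>G\<^esub> g"] g nz u_one u_closed by simp

section \<open>Products of homogeneous elements under a covariant representation\<close>

locale covariant_sigma_representation =
  twisted_unital_partial_action K G A D u \<theta> \<sigma> + T: unital_algebra K R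
  for K :: "('k, 'm) ring_scheme" (structure)
    and G :: "('g, 'n) monoid_scheme" (structure)
    and A :: "('k, 'a, 'p) module_scheme" (structure)
    and D u \<theta> \<sigma>
    and R :: "('k, 'r, 'q) module_scheme" (structure)
    and \<pi> :: "'a \<Rightarrow> 'r" and \<Gamma> :: "'g \<Rightarrow> 'r" +
  assumes covariant_rep: "covariant_sigma_rep K G A D \<theta> \<sigma> R \<pi> \<Gamma>"
begin

lemma pi_lin_map: "\<pi> \<in> lin_map K A R"
  using covariant_rep by (simp add: covariant_sigma_rep_def alg_hom_def)

lemma pi_closed: "a \<in> carrier A \<Longrightarrow> \<pi> a \<in> carrier R"
  using pi_lin_map by (auto simp: lin_map_def)

lemma pi_add: "\<lbrakk>a \<in> carrier A; b \<in> carrier A\<rbrakk> \<Longrightarrow> \<pi> (a \<oplus>\<^bsub>A\<^esub> b) = \<pi> a \<oplus>\<^bsub>R\<^esub> \<pi> b"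
  using pi_lin_map by (auto simp: lin_map_def)

lemma pi_smult: "\<lbrakk>k \<in> carrier K; a \<in> carrier A\<rbrakk> \<Longrightarrow> \<pi> (k \<odot>\<^bsub>A\<^esub> a) = k \<odot>\<^bsub>R\<^esub> \<pi> a"
  using pi_lin_map by (auto simp: lin_map_def)

lemma pi_mult: "\<lbrakk>a \<in> carrier A; b \<in> carrier A\<rbrakk> \<Longrightarrow> \<pi> (a \<otimes>\<^bsub>A\<^esub> b) = \<pi> a \<otimes>\<^bsub>R\<^esub> \<pi> b"
  using covariant_rep by (simp add: covariant_sigma_rep_def alg_hom_def)

lemma pi_zero: "\<pi> \<zero>\<^bsub>A\<^esub> = \<zero>\<^bsub>R\<^esub>"
  using pi_smult[of "\<zero>\<^bsub>K\<^esub>" "\<zero>\<^bsub>A\<^esub>"] pi_closed[of "\<zero>\<^bsub>A\<^esub>"] by simp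

lemma Gamma_closed: "g \<in> carrier G \<Longrightarrow> \<Gamma> g \<in> carrier R"
  using covariant_rep by (auto simp: covariant_sigma_rep_def partial_sigma_rep_def)

lemma Gamma_mult_left:
  "\<lbrakk>g \<in> carrier G; h \<in> carrier G\<rbrakk> \<Longrightarrow>
    \<Gamma> (inv\<^bsub>G\<^esub> g) \<otimes>\<^bsub>R\<^esub> \<Gamma> g \<otimes>\<^bsub>R\<^esub> \<Gamma> h = \<sigma> g h \<odot>\<^bsub>R\<^esub> (\<Gamma> (inv\<^bsub>G\<^esub> g) \<otimes>\<^bsub>R\<^esub> \<Gamma> (g \<otimes>\<^bsub>G\<^esub> h))"
  using covariant_rep by (simp add: covariant_sigma_rep_def partial_sigma_rep_def)

lemma Gamma_mult_right:
  "\<lbrakk>g \<in> carrier G; h \<in> carrier G\<rbrakk> \<Longrightarrow>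
    \<Gamma> g \<otimes>\<^bsub>R\<^esub> \<Gamma> h \<otimes>\<^bsub>R\<^esub> \<Gamma> (inv\<^bsub>G\<^esub> h) = \<sigma> g h \<odot>\<^bsub>R\<^esub> (\<Gamma> (g \<otimes>\<^bsub>G\<^esub> h) \<otimes>\<^bsub>R\<^esub> \<Gamma> (inv\<^bsub>G\<^esub> h))"
  using covariant_rep by (simp add: covariant_sigma_rep_def partial_sigma_rep_def)

text \<open>
  The relation \<open>Gamma_mult_right\<close> for $(g,g^{-1})$. Up to the scalar $\sigma(g,g^{-1})$ it makes
  $\Gamma(g)\Gamma(g^{-1})$ an idempotent.
\<close>

lemma Gamma_inv_Gamma:
  assumes g: "g \<in> carrier G"
  shows "\<Gamma> g \<otimes>\<^bsub>R\<^esub> \<Gamma> (inv\<^bsub>G\<^esub> g) \<otimes>\<^bsub>R\<^esub> \<Gamma> g = \<sigma> g (inv\<^bsub>G\<^esub> g) \<odot>\<^bsub>R\<^esub> \<Gamma> g"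
proof -
  have "\<Gamma> \<one>\<^bsub>G\<^esub> = \<one>\<^bsub>R\<^esub>"
    using covariant_rep by (simp add: covariant_sigma_rep_def partial_sigma_rep_def)
  then show ?thesis using Gamma_mult_right[of g "inv\<^bsub>G\<^esub> g"] g Gamma_closed by simp
qed

lemma Gamma_covariant:
  "\<lbrakk>g \<in> carrier G; a \<in> D (inv\<^bsub>G\<^esub> g)\<rbrakk> \<Longrightarrow>
    \<Gamma> g \<otimes>\<^bsub>R\<^esub> \<pi> a \<otimes>\<^bsub>R\<^esub> \<Gamma> (inv\<^bsub>G\<^esub> g) = \<sigma> g (inv\<^bsub>G\<^esub> g) \<odot>\<^bsub>R\<^esub> \<pi> (\<theta> g a)"
  using covariant_rep by (simp add: covariant_sigma_rep_def)

text \<open>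
  Write $F = \Gamma(g)\Gamma(g^{-1})$, $s = \sigma(g,g^{-1})$ and $t = \sigma(g^{-1},g)\,s$. From
  $F\pi(a)F = t\,\pi(a)$ and $F^2 = sF$ one obtains $t\,F\pi(a) = FF\pi(a)F = st\,\pi(a)$, and likewise
  on the right; then $t$ is cancelled, which is possible unless $1_g = 0$ and hence $a = 0$.
\<close>

lemma range_projection_fixes_pi:
  assumes g: "g \<in> carrier G" and a: "a \<in> D g"
  shows "\<Gamma> g \<otimes>\<^bsub>R\<^esub> \<Gamma> (inv\<^bsub>G\<^esub> g) \<otimes>\<^bsub>R\<^esub> \<pi> a = \<sigma> g (inv\<^bsub>G\<^esub> g) \<odot>\<^bsub>R\<^esub> \<pi> a" (is ?left)
    and "\<pi> a \<otimes>\<^bsub>R\<^esub> (\<Gamma> g \<otimes>\<^bsub>R\<^esub> \<Gamma> (inv\<^bsub>G\<^esub> g)) = \<sigma> g (inv\<^bsub>G\<^esub> g) \<odot>\<^bsub>R\<^esub> \<pi> a" (is ?right)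
proof -
  let ?g' = "inv\<^bsub>G\<^esub> g"
  let ?F = "\<Gamma> g \<otimes>\<^bsub>R\<^esub> \<Gamma> ?g'"
  let ?s = "\<sigma> g ?g'" and ?s' = "\<sigma> ?g' g"
  let ?t = "?s' \<otimes>\<^bsub>K\<^esub> ?s"
  have g': "?g' \<in> carrier G" and s: "?s \<in> carrier K" and s': "?s' \<in> carrier K"
    using g twist_closed by auto
  have Gg: "\<Gamma> g \<in> carrier R" and Gg': "\<Gamma> ?g' \<in> carrier R" and F: "?F \<in> carrier R"
    using g g' Gamma_closed by auto
  have ac: "a \<in> carrier A" using g a D_carrier by blast
  then have P: "\<pi> a \<in> carrier R" by (rule pi_closed)
  have th: "\<theta> ?g' a \<in> D ?g'" using theta_closed[OF g'] a g by simp
  then have Pth: "\<pi> (\<theta> ?g' a) \<in> carrier R" using D_carrier[OF g'] pi_closed by simp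
  have FF: "?F \<otimes>\<^bsub>R\<^esub> ?F = ?s \<odot>\<^bsub>R\<^esub> ?F"
  proof -
    have "?F \<otimes>\<^bsub>R\<^esub> ?F = (\<Gamma> g \<otimes>\<^bsub>R\<^esub> \<Gamma> ?g' \<otimes>\<^bsub>R\<^esub> \<Gamma> g) \<otimes>\<^bsub>R\<^esub> \<Gamma> ?g'"
      using Gg Gg' by (simp add: T.m_assoc)
    also have "\<dots> = ?s \<odot>\<^bsub>R\<^esub> ?F"
      unfolding Gamma_inv_Gamma[OF g] by (rule T.smult_mult_left[OF s Gg Gg'])
    finally show ?thesis .
  qed
  \<comment> \<open>covariance for $g^{-1}$ inside, then for $g$ outside\<close>
  have FPF: "?F \<otimes>\<^bsub>R\<^esub> \<pi> a \<otimes>\<^bsub>R\<^esub> ?F = ?t \<odot>\<^bsub>R\<^esub> \<pi> a"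
  proof -
    have "?F \<otimes>\<^bsub>R\<^esub> \<pi> a \<otimes>\<^bsub>R\<^esub> ?F = \<Gamma> g \<otimes>\<^bsub>R\<^esub> (\<Gamma> ?g' \<otimes>\<^bsub>R\<^esub> \<pi> a \<otimes>\<^bsub>R\<^esub> \<Gamma> g) \<otimes>\<^bsub>R\<^esub> \<Gamma> ?g'"
      using Gg Gg' P by (simp add: T.m_assoc)
    also have "\<Gamma> ?g' \<otimes>\<^bsub>R\<^esub> \<pi> a \<otimes>\<^bsub>R\<^esub> \<Gamma> g = ?s' \<odot>\<^bsub>R\<^esub> \<pi> (\<theta> ?g' a)"
      using Gamma_covariant[OF g', of a] g a by simp
    also have "\<Gamma> g \<otimes>\<^bsub>R\<^esub> (?s' \<odot>\<^bsub>R\<^esub> \<pi> (\<theta> ?g' a)) \<otimes>\<^bsub>R\<^esub> \<Gamma> ?g'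
        = ?s' \<odot>\<^bsub>R\<^esub> (\<Gamma> g \<otimes>\<^bsub>R\<^esub> \<pi> (\<theta> ?g' a) \<otimes>\<^bsub>R\<^esub> \<Gamma> ?g')"
      using s' Gg Gg' Pth by (simp add: T.smult_mult_left T.smult_mult_right)
    also have "\<dots> = ?t \<odot>\<^bsub>R\<^esub> \<pi> a"
      using Gamma_covariant[OF g th] theta_theta_inv[OF g a] s s' P by (simp add: T.smult_assoc1)
    finally show ?thesis .
  qed
  have t: "?t \<in> carrier K" using s s' by simp
  have tl: "?t \<odot>\<^bsub>R\<^esub> (?F \<otimes>\<^bsub>R\<^esub> \<pi> a) = ?t \<odot>\<^bsub>R\<^esub> (?s \<odot>\<^bsub>R\<^esub> \<pi> a)"
  proof -
    have "?t \<odot>\<^bsub>R\<^esub> (?F \<otimes>\<^bsub>R\<^esub> \<pi> a) = ?F \<otimes>\<^bsub>R\<^esub> (?F \<otimes>\<^bsub>R\<^esub> \<pi> a \<otimes>\<^bsub>R\<^esub> ?F)"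
      unfolding FPF using T.smult_mult_right[OF t F P] by simp
    also have "\<dots> = (?F \<otimes>\<^bsub>R\<^esub> ?F) \<otimes>\<^bsub>R\<^esub> \<pi> a \<otimes>\<^bsub>R\<^esub> ?F"
      using F P by (simp add: T.m_assoc del: T.m_closed) (simp add: T.m_assoc Gg Gg' P)
    also have "\<dots> = ?s \<odot>\<^bsub>R\<^esub> (?t \<odot>\<^bsub>R\<^esub> \<pi> a)"
      unfolding FF using s F P FPF by (simp add: T.smult_mult_left)
    also have "\<dots> = ?t \<odot>\<^bsub>R\<^esub> (?s \<odot>\<^bsub>R\<^esub> \<pi> a)"
      using s t P K.m_comm[of ?s ?t] by (simp flip: T.smult_assoc1)
    finally show ?thesis .
  qed
  have tr: "?t \<odot>\<^bsub>R\<^esub> (\<pi> a \<otimes>\<^bsub>R\<^esub> ?F) = ?t \<odot>\<^bsub>R\<^esub> (?s \<odot>\<^bsub>R\<^esub> \<pi> a)"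
  proof -
    have "?t \<odot>\<^bsub>R\<^esub> (\<pi> a \<otimes>\<^bsub>R\<^esub> ?F) = (?F \<otimes>\<^bsub>R\<^esub> \<pi> a \<otimes>\<^bsub>R\<^esub> ?F) \<otimes>\<^bsub>R\<^esub> ?F"
      unfolding FPF using T.smult_mult_left[OF t P F] by simp
    also have "\<dots> = ?F \<otimes>\<^bsub>R\<^esub> \<pi> a \<otimes>\<^bsub>R\<^esub> (?F \<otimes>\<^bsub>R\<^esub> ?F)"
      using T.m_assoc[of "?F \<otimes>\<^bsub>R\<^esub> \<pi> a" ?F ?F] F P by simp
    also have "\<dots> = ?s \<odot>\<^bsub>R\<^esub> (?t \<odot>\<^bsub>R\<^esub> \<pi> a)"
      unfolding FF using s F P FPF by (simp add: T.smult_mult_right)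
    also have "\<dots> = ?t \<odot>\<^bsub>R\<^esub> (?s \<odot>\<^bsub>R\<^esub> \<pi> a)"
      using s t P K.m_comm[of ?s ?t] by (simp flip: T.smult_assoc1)
    finally show ?thesis .
  qed
  have "?left \<and> ?right"
  proof (cases "u g = \<zero>\<^bsub>A\<^esub>")
    case True
    then have "a = \<zero>\<^bsub>A\<^esub>" using u_mult_D[OF g a] ac by simp
    then show ?thesis using pi_zero F s by simp
  next
    case False
    then have "?t \<noteq> \<zero>\<^bsub>K\<^esub>"
      using twist_inv_nonzero[OF g] twist_inv_nonzero[OF g'] u_inv_nonzero[OF g] g s s'
        K.integral_iff by simp
    then show ?thesis
      using T.smult_left_cancel[OF K.field_axioms t] tl tr F P s by simp
  qed
  then show ?left and ?right by auto
qed


text \<open>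
  The identity holds after multiplication by $s = \sigma(g,g^{-1})$, which is cancelled at the end: the
  step \<open>push\<close> carries $\pi(a)$ from the left of $\Gamma(g)$ to its right, where it is absorbed into
  $\pi(c)$, and the step \<open>merge\<close> inserts $\Gamma(g^{-1})\Gamma(g)$ after $\pi(c)$ in order to
  combine $\Gamma(g)$ with $\Gamma(h)$. Taking $c = \theta_{g^{-1}}(a)\,(1_{g^{-1}}b)$ rather than the
  equal $\theta_{g^{-1}}(a)b$ puts both factors in $D_{g^{-1}}$, where $\theta_g$ is multiplicative.
\<close>

lemma homogeneous_mult:
  assumes g: "g \<in> carrier G" and h: "h \<in> carrier G" and a: "a \<in> D g" and b: "b \<in> D h"
  shows "(\<pi> a \<otimes>\<^bsub>R\<^esub> \<Gamma> g) \<otimes>\<^bsub>R\<^esub> (\<pi> b \<otimes>\<^bsub>R\<^esub> \<Gamma> h)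
    = \<pi> (\<sigma> g h \<odot>\<^bsub>A\<^esub> (a \<otimes>\<^bsub>A\<^esub> \<theta> g (u (inv\<^bsub>G\<^esub> g) \<otimes>\<^bsub>A\<^esub> b))) \<otimes>\<^bsub>R\<^esub> \<Gamma> (g \<otimes>\<^bsub>G\<^esub> h)"
    (is "?lhs = ?rhs")
proof -
  let ?g' = "inv\<^bsub>G\<^esub> g"
  let ?s = "\<sigma> g ?g'" and ?s' = "\<sigma> ?g' g"
  let ?ub = "u ?g' \<otimes>\<^bsub>A\<^esub> b"
  let ?c = "\<theta> ?g' a \<otimes>\<^bsub>A\<^esub> ?ub"
  have g': "?g' \<in> carrier G" and gh: "g \<otimes>\<^bsub>G\<^esub> h \<in> carrier G" using g h by auto
  have s: "?s \<in> carrier K" and s': "?s' \<in> carrier K" and sgh: "\<sigma> g h \<in> carrier K"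
    using g h twist_closed by auto
  have G: "\<Gamma> g \<in> carrier R" "\<Gamma> ?g' \<in> carrier R" "\<Gamma> h \<in> carrier R" "\<Gamma> (g \<otimes>\<^bsub>G\<^esub> h) \<in> carrier R"
    using g g' h gh Gamma_closed by auto
  have ac: "a \<in> carrier A" and bc: "b \<in> carrier A" using g h a b D_carrier by auto
  have ua: "\<theta> ?g' a \<in> D ?g'" using theta_closed[OF g'] a g by simp
  then have uac: "\<theta> ?g' a \<in> carrier A" using D_carrier[OF g'] by simp
  have uc: "u ?g' \<in> carrier A" using u_closed[OF g'] .
  have ub: "?ub \<in> D ?g'" using ideal.I_r_closed[OF ideal_D[OF g'] u_in_D[OF g'] bc] .
  have ubc: "?ub \<in> carrier A" using D_carrier[OF g' ub] .
  have c: "?c \<in> D ?g'" using ideal.I_r_closed[OF ideal_D[OF g'] ua ubc] .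
  have cc: "?c \<in> carrier A" using D_carrier[OF g' c] .
  have c_eq: "?c = \<theta> ?g' a \<otimes>\<^bsub>A\<^esub> b"
    using u_mult_D[OF g' ua] u_central[OF g' uac] uac uc bc by (simp flip: A.m_assoc)
  have theta_c: "\<theta> g ?c = a \<otimes>\<^bsub>A\<^esub> \<theta> g ?ub"
    using theta_mult[OF g ua ub] theta_theta_inv[OF g a] by simp
  have tc: "\<theta> g ?c \<in> carrier A" using D_carrier[OF g] theta_closed[OF g c] by simp
  have P: "\<pi> a \<in> carrier R" "\<pi> b \<in> carrier R" "\<pi> (\<theta> ?g' a) \<in> carrier R" "\<pi> ?c \<in> carrier R"
      "\<pi> (\<theta> g ?c) \<in> carrier R"
    using ac bc uac cc tc pi_closed by auto
  
  have push: "?s \<odot>\<^bsub>R\<^esub> (\<pi> a \<otimes>\<^bsub>R\<^esub> \<Gamma> g) = ?s' \<odot>\<^bsub>R\<^esub> (\<Gamma> g \<otimes>\<^bsub>R\<^esub> \<pi> (\<theta> ?g' a))"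
  proof -
    have "?s \<odot>\<^bsub>R\<^esub> (\<pi> a \<otimes>\<^bsub>R\<^esub> \<Gamma> g) = (?s \<odot>\<^bsub>R\<^esub> \<pi> a) \<otimes>\<^bsub>R\<^esub> \<Gamma> g"
      using T.smult_mult_left[OF s P(1) G(1)] by simp
    also have "\<dots> = \<Gamma> g \<otimes>\<^bsub>R\<^esub> (\<Gamma> ?g' \<otimes>\<^bsub>R\<^esub> \<pi> a \<otimes>\<^bsub>R\<^esub> \<Gamma> g)"
      using G P by (simp add: T.m_assoc flip: range_projection_fixes_pi(1)[OF g a])
    also have "\<dots> = \<Gamma> g \<otimes>\<^bsub>R\<^esub> (?s' \<odot>\<^bsub>R\<^esub> \<pi> (\<theta> ?g' a))"
      using Gamma_covariant[OF g', of a] a g by simp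
    also have "\<dots> = ?s' \<odot>\<^bsub>R\<^esub> (\<Gamma> g \<otimes>\<^bsub>R\<^esub> \<pi> (\<theta> ?g' a))"
      by (rule T.smult_mult_right[OF s' G(1) P(3)])
    finally show ?thesis .
  qed
  have merge: "?s' \<odot>\<^bsub>R\<^esub> (\<Gamma> g \<otimes>\<^bsub>R\<^esub> \<pi> ?c \<otimes>\<^bsub>R\<^esub> \<Gamma> h)
      = ?s \<odot>\<^bsub>R\<^esub> (\<sigma> g h \<odot>\<^bsub>R\<^esub> (\<pi> (\<theta> g ?c) \<otimes>\<^bsub>R\<^esub> \<Gamma> (g \<otimes>\<^bsub>G\<^esub> h)))"
  proof -
    have "?s' \<odot>\<^bsub>R\<^esub> (\<Gamma> g \<otimes>\<^bsub>R\<^esub> \<pi> ?c \<otimes>\<^bsub>R\<^esub> \<Gamma> h) = \<Gamma> g \<otimes>\<^bsub>R\<^esub> (?s' \<odot>\<^bsub>R\<^esub> \<pi> ?c) \<otimes>\<^bsub>R\<^esub> \<Gamma> h"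
      using s' G P by (simp add: T.smult_mult_left T.smult_mult_right)
    also have "?s' \<odot>\<^bsub>R\<^esub> \<pi> ?c = \<pi> ?c \<otimes>\<^bsub>R\<^esub> (\<Gamma> ?g' \<otimes>\<^bsub>R\<^esub> \<Gamma> g)"
      using range_projection_fixes_pi(2)[OF g' c] g by simp
    also have "\<Gamma> g \<otimes>\<^bsub>R\<^esub> (\<pi> ?c \<otimes>\<^bsub>R\<^esub> (\<Gamma> ?g' \<otimes>\<^bsub>R\<^esub> \<Gamma> g)) \<otimes>\<^bsub>R\<^esub> \<Gamma> h
        = \<Gamma> g \<otimes>\<^bsub>R\<^esub> \<pi> ?c \<otimes>\<^bsub>R\<^esub> (\<Gamma> ?g' \<otimes>\<^bsub>R\<^esub> \<Gamma> g \<otimes>\<^bsub>R\<^esub> \<Gamma> h)"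
      using G P by (simp add: T.m_assoc)
    also have "\<dots> = \<sigma> g h \<odot>\<^bsub>R\<^esub> (\<Gamma> g \<otimes>\<^bsub>R\<^esub> \<pi> ?c \<otimes>\<^bsub>R\<^esub> (\<Gamma> ?g' \<otimes>\<^bsub>R\<^esub> \<Gamma> (g \<otimes>\<^bsub>G\<^esub> h)))"
      unfolding Gamma_mult_left[OF g h] using sgh G P by (simp add: T.smult_mult_right)
    also have "\<Gamma> g \<otimes>\<^bsub>R\<^esub> \<pi> ?c \<otimes>\<^bsub>R\<^esub> (\<Gamma> ?g' \<otimes>\<^bsub>R\<^esub> \<Gamma> (g \<otimes>\<^bsub>G\<^esub> h))
        = (\<Gamma> g \<otimes>\<^bsub>R\<^esub> \<pi> ?c \<otimes>\<^bsub>R\<^esub> \<Gamma> ?g') \<otimes>\<^bsub>R\<^esub> \<Gamma> (g \<otimes>\<^bsub>G\<^esub> h)"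
      using G P by (simp add: T.m_assoc)
    also have "\<dots> = ?s \<odot>\<^bsub>R\<^esub> (\<pi> (\<theta> g ?c) \<otimes>\<^bsub>R\<^esub> \<Gamma> (g \<otimes>\<^bsub>G\<^esub> h))"
      unfolding Gamma_covariant[OF g c] by (rule T.smult_mult_left[OF s P(5) G(4)])
    finally show ?thesis
      using s sgh G P K.m_comm[of "\<sigma> g h" ?s] by (simp flip: T.smult_assoc1)
  qed
  have rhs: "?rhs = \<sigma> g h \<odot>\<^bsub>R\<^esub> (\<pi> (\<theta> g ?c) \<otimes>\<^bsub>R\<^esub> \<Gamma> (g \<otimes>\<^bsub>G\<^esub> h))"
    unfolding theta_c[symmetric] pi_smult[OF sgh tc] by (rule T.smult_mult_left[OF sgh P(5) G(4)])
  have scaled: "?s \<odot>\<^bsub>R\<^esub> ?lhs = ?s \<odot>\<^bsub>R\<^esub> ?rhs"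
  proof -
    have "?s \<odot>\<^bsub>R\<^esub> ?lhs = (?s \<odot>\<^bsub>R\<^esub> (\<pi> a \<otimes>\<^bsub>R\<^esub> \<Gamma> g)) \<otimes>\<^bsub>R\<^esub> (\<pi> b \<otimes>\<^bsub>R\<^esub> \<Gamma> h)"
      using s G P by (simp add: T.smult_mult_left)
    also have "\<dots> = ?s' \<odot>\<^bsub>R\<^esub> (\<Gamma> g \<otimes>\<^bsub>R\<^esub> (\<pi> (\<theta> ?g' a) \<otimes>\<^bsub>R\<^esub> \<pi> b) \<otimes>\<^bsub>R\<^esub> \<Gamma> h)"
      unfolding push using s' G P by (simp add: T.smult_mult_left T.m_assoc)
    also have "\<pi> (\<theta> ?g' a) \<otimes>\<^bsub>R\<^esub> \<pi> b = \<pi> ?c"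
      unfolding c_eq using pi_mult[OF uac bc] by simp
    finally show ?thesis using merge rhs by simp
  qed
  show ?thesis
  proof (cases "u g = \<zero>\<^bsub>A\<^esub>")
    case True
    then have "a = \<zero>\<^bsub>A\<^esub>" using u_mult_D[OF g a] ac by simp
    then show ?thesis
      using pi_zero G P sgh D_carrier[OF g theta_closed[OF g ub]] by simp
  next
    case False
    have "?lhs \<in> carrier R" and "?rhs \<in> carrier R" using rhs G P sgh by auto
    then show ?thesis
      using T.smult_left_cancel[OF K.field_axioms s twist_inv_nonzero[OF g False]] scaled by blast
  qed
qed

end

section \<open>The homomorphism on the crossed product\<close>

context unital_partial_action
begin

lemma crossed_product_component:
  "\<lbrakk>f \<in> carrier (crossed_product G A D u \<theta> \<sigma>); g \<in> carrier G\<rbrakk> \<Longrightarrow> f g \<in> D g"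
  by (auto simp: crossed_product_def)

lemma finite_supp: "f \<in> carrier (crossed_product G A D u \<theta> \<sigma>) \<Longrightarrow> finite (supp G A f)"
  by (simp add: crossed_product_def)

text \<open>
  Homogeneous elements span: peeling off $f(g)\delta_g$ shrinks the support. The element with empty
  support is itself homogeneous, namely $0\delta_1$.
\<close>

lemma lin_map_eq_if_eq_on_delta:
  assumes lin: "\<phi> \<in> lin_map K (crossed_product G A D u \<theta> \<sigma>) B"
      "\<psi> \<in> lin_map K (crossed_product G A D u \<theta> \<sigma>) B"
    and eq: "\<And>g a. \<lbrakk>g \<in> carrier G; a \<in> D g\<rbrakk> \<Longrightarrow> \<phi> (delta G A a g) = \<psi> (delta G A a g)"
    and f: "f \<in> carrier (crossed_product G A D u \<theta> \<sigma>)"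
  shows "\<phi> f = \<psi> f"
proof -
  let ?C = "crossed_product G A D u \<theta> \<sigma>"
  have "\<phi> f = \<psi> f" if "finite S" "supp G A f \<subseteq> S" "f \<in> carrier ?C" for S
    using that
  proof (induction S arbitrary: f rule: finite_induct)
    case empty
    then have "f = delta G A \<zero>\<^bsub>A\<^esub> \<one>\<^bsub>G\<^esub>"
      by (auto simp: supp_def delta_def crossed_product_def fun_eq_iff PiE_def extensional_def)
    then show ?case using eq[of "\<one>\<^bsub>G\<^esub>" "\<zero>\<^bsub>A\<^esub>"] zero_in_D by simp
  next
    case (insert g S)
    show ?case
    proof (cases "g \<in> carrier G")
      case False
      then have "supp G A f \<subseteq> S" using insert.prems(1) by (auto simp: supp_def)
      then show ?thesis using insert.IH insert.prems(2) by blast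
    next
      case g: True
      define r where "r = f(g := \<zero>\<^bsub>A\<^esub>)"
      have comp: "f x \<in> carrier A" if "x \<in> carrier G" for x
        using crossed_product_component[OF insert.prems(2) that] D_carrier that by blast
      have r_supp: "supp G A r \<subseteq> S" using insert.prems(1) by (auto simp: supp_def r_def)
      have r: "r \<in> carrier ?C"
        using insert.prems(2) g zero_in_D[OF g] finite_subset[OF r_supp insert.hyps(1)]
        by (auto simp: crossed_product_def r_def PiE_def extensional_def)
      have fg: "f g \<in> D g" using crossed_product_component[OF insert.prems(2) g] .
      have d: "delta G A (f g) g \<in> carrier ?C" by (rule delta_closed[OF g fg])
      have "f = delta G A (f g) g \<oplus>\<^bsub>?C\<^esub> r"
        using insert.prems(2) g comp
        by (auto simp: crossed_product_def delta_def r_def fun_eq_iff PiE_def extensional_def)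
      moreover have "\<phi> (delta G A (f g) g \<oplus>\<^bsub>?C\<^esub> r) = \<psi> (delta G A (f g) g \<oplus>\<^bsub>?C\<^esub> r)"
        using lin d r eq[OF g fg] insert.IH[OF r_supp r] by (simp add: lin_map_def)
      ultimately show ?thesis by simp
    qed
  qed
  then show ?thesis using finite_supp[OF f] f by blast
qed

end

context covariant_sigma_representation
begin

text \<open>
  Allowing any finite index set around the support makes sums over different supports comparable:
  supports may shrink under addition, scaling and multiplication.
\<close>

lemma integrated_map_eq_finsum:
  assumes S: "finite S" "supp G A f \<subseteq> S" "S \<subseteq> carrier G" and f: "f \<in> carrier G \<rightarrow> carrier A"
  shows "integrated_map G A R \<pi> \<Gamma> f = (\<Oplus>\<^bsub>R\<^esub>g\<in>S. \<pi> (f g) \<otimes>\<^bsub>R\<^esub> \<Gamma> g)"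
  unfolding integrated_map_def
proof (rule T.M.add.finprod_mono_neutral_cong_left[OF S(1,2)])
  fix g assume "g \<in> S - supp G A f"
  then have "f g = \<zero>\<^bsub>A\<^esub>" and "g \<in> carrier G" using S(3) by (auto simp: supp_def)
  then show "\<pi> (f g) \<otimes>\<^bsub>R\<^esub> \<Gamma> g = \<zero>\<^bsub>R\<^esub>" using pi_zero Gamma_closed by simp
next
  show "(\<lambda>g. \<pi> (f g) \<otimes>\<^bsub>R\<^esub> \<Gamma> g) \<in> S \<rightarrow> carrier R"
    using S(3) f pi_closed Gamma_closed by (auto simp: Pi_iff subset_iff)
qed simp

lemma integrated_map_delta:
  assumes g: "g \<in> carrier G" and a: "a \<in> D g"
  shows "integrated_map G A R \<pi> \<Gamma> (delta G A a g) = \<pi> a \<otimes>\<^bsub>R\<^esub> \<Gamma> g"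
proof -
  have ac: "a \<in> carrier A" using g a D_carrier by blast
  have "integrated_map G A R \<pi> \<Gamma> (delta G A a g)
      = (\<Oplus>\<^bsub>R\<^esub>x\<in>{g}. \<pi> (delta G A a g x) \<otimes>\<^bsub>R\<^esub> \<Gamma> x)"
    by (rule integrated_map_eq_finsum) (use g ac in \<open>auto simp: supp_delta, auto simp: delta_def\<close>)
  then show ?thesis using g ac pi_closed Gamma_closed by (simp add: delta_def)
qed

lemma integrated_map_lin_map:
  "integrated_map G A R \<pi> \<Gamma> \<in> lin_map K (crossed_product G A D u \<theta> \<sigma>) R"
proof -
  let ?C = "crossed_product G A D u \<theta> \<sigma>" and ?I = "integrated_map G A R \<pi> \<Gamma>"
  have comp: "f \<in> carrier G \<rightarrow> carrier A" if "f \<in> carrier ?C" for f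
    using crossed_product_component[OF that] D_carrier by blast
  have summand: "(\<lambda>g. \<pi> (f g) \<otimes>\<^bsub>R\<^esub> \<Gamma> g) \<in> S \<rightarrow> carrier R"
    if "f \<in> carrier ?C" "S \<subseteq> carrier G" for f S
    using comp[OF that(1)] that(2) pi_closed Gamma_closed by (auto simp: Pi_iff subset_iff)
  have sub: "supp G A f \<subseteq> carrier G" for f :: "'g \<Rightarrow> 'a" by (auto simp: supp_def)
  have closed: "?I f \<in> carrier R" if "f \<in> carrier ?C" for f
    unfolding integrated_map_def by (rule T.M.finsum_closed[OF summand[OF that sub]])
  have add: "?I (f \<oplus>\<^bsub>?C\<^esub> f') = ?I f \<oplus>\<^bsub>R\<^esub> ?I f'"
    if f: "f \<in> carrier ?C" and f': "f' \<in> carrier ?C" for f f'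
  proof -
    let ?S = "supp G A f \<union> supp G A f'"
    have S: "finite ?S" "?S \<subseteq> carrier G" using finite_supp f f' sub by auto
    have sum: "f \<oplus>\<^bsub>?C\<^esub> f' = (\<lambda>x\<in>carrier G. f x \<oplus>\<^bsub>A\<^esub> f' x)" by (simp add: crossed_product_def)
    have "?I (f \<oplus>\<^bsub>?C\<^esub> f') = (\<Oplus>\<^bsub>R\<^esub>g\<in>?S. \<pi> ((f \<oplus>\<^bsub>?C\<^esub> f') g) \<otimes>\<^bsub>R\<^esub> \<Gamma> g)"
      by (rule integrated_map_eq_finsum)
        (use S comp[OF f] comp[OF f'] in \<open>auto simp: sum supp_def Pi_iff\<close>)
    also have "\<dots> = (\<Oplus>\<^bsub>R\<^esub>g\<in>?S. \<pi> (f g) \<otimes>\<^bsub>R\<^esub> \<Gamma> g \<oplus>\<^bsub>R\<^esub> \<pi> (f' g) \<otimes>\<^bsub>R\<^esub> \<Gamma> g)"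
    proof (rule T.M.finsum_cong')
      fix g assume "g \<in> ?S"
      then have g: "g \<in> carrier G" using S by blast
      then have c: "f g \<in> carrier A" "f' g \<in> carrier A" using comp f f' by blast+
      then show "\<pi> ((f \<oplus>\<^bsub>?C\<^esub> f') g) \<otimes>\<^bsub>R\<^esub> \<Gamma> g
          = \<pi> (f g) \<otimes>\<^bsub>R\<^esub> \<Gamma> g \<oplus>\<^bsub>R\<^esub> \<pi> (f' g) \<otimes>\<^bsub>R\<^esub> \<Gamma> g"
        using g pi_closed Gamma_closed by (simp add: sum pi_add T.l_distr)
    qed (use summand[OF f S(2)] summand[OF f' S(2)] in \<open>auto simp: Pi_iff\<close>)
    also have "\<dots> = (\<Oplus>\<^bsub>R\<^esub>g\<in>?S. \<pi> (f g) \<otimes>\<^bsub>R\<^esub> \<Gamma> g) \<oplus>\<^bsub>R\<^esub> (\<Oplus>\<^bsub>R\<^esub>g\<in>?S. \<pi> (f' g) \<otimes>\<^bsub>R\<^esub> \<Gamma> g)"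
      by (rule T.M.finsum_addf) (use summand[OF f S(2)] summand[OF f' S(2)] in auto)
    also have "\<dots> = ?I f \<oplus>\<^bsub>R\<^esub> ?I f'"
      using integrated_map_eq_finsum[OF S(1) _ S(2) comp[OF f]]
        integrated_map_eq_finsum[OF S(1) _ S(2) comp[OF f']] by simp
    finally show ?thesis .
  qed
  have smult: "?I (k \<odot>\<^bsub>?C\<^esub> f) = k \<odot>\<^bsub>R\<^esub> ?I f" if k: "k \<in> carrier K" and f: "f \<in> carrier ?C" for k f
  proof -
    let ?S = "supp G A f"
    have S: "finite ?S" "?S \<subseteq> carrier G" using finite_supp[OF f] sub by auto
    have scale: "k \<odot>\<^bsub>?C\<^esub> f = (\<lambda>x\<in>carrier G. k \<odot>\<^bsub>A\<^esub> f x)" by (simp add: crossed_product_def)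
    have "?I (k \<odot>\<^bsub>?C\<^esub> f) = (\<Oplus>\<^bsub>R\<^esub>g\<in>?S. \<pi> ((k \<odot>\<^bsub>?C\<^esub> f) g) \<otimes>\<^bsub>R\<^esub> \<Gamma> g)"
      by (rule integrated_map_eq_finsum)
        (use S comp[OF f] k in \<open>auto simp: scale supp_def Pi_iff\<close>)
    also have "\<dots> = (\<Oplus>\<^bsub>R\<^esub>g\<in>?S. k \<odot>\<^bsub>R\<^esub> (\<pi> (f g) \<otimes>\<^bsub>R\<^esub> \<Gamma> g))"
    proof (rule T.M.finsum_cong')
      fix g assume "g \<in> ?S"
      then have g: "g \<in> carrier G" using S by blast
      then have c: "f g \<in> carrier A" using comp f by blast
      then show "\<pi> ((k \<odot>\<^bsub>?C\<^esub> f) g) \<otimes>\<^bsub>R\<^esub> \<Gamma> g = k \<odot>\<^bsub>R\<^esub> (\<pi> (f g) \<otimes>\<^bsub>R\<^esub> \<Gamma> g)"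
        using g k pi_closed Gamma_closed by (simp add: scale pi_smult T.smult_mult_left)
    qed (use summand[OF f S(2)] k in \<open>auto simp: Pi_iff\<close>)
    also have "\<dots> = k \<odot>\<^bsub>R\<^esub> ?I f"
      unfolding integrated_map_def
      using T.finsum_smult_ldistr[OF S(1) k summand[OF f S(2)]] by simp
    finally show ?thesis .
  qed
  show ?thesis using closed add smult by (auto simp: lin_map_def)
qed

text \<open>
  Both sides are the sum over all pairs \<open>p\<close> of indices from the two supports of the same product of
  homogeneous images: the right-hand side by distributivity, the left-hand side after grouping the
  pairs by their product in \<open>G\<close>. Here \<open>w p\<close> is the contribution of the pair \<open>p\<close> to the
  coefficient at \<open>m p\<close>.
\<close>

lemma integrated_map_mult:
  assumes f: "f \<in> carrier (crossed_product G A D u \<theta> \<sigma>)"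
    and f': "f' \<in> carrier (crossed_product G A D u \<theta> \<sigma>)"
  shows "integrated_map G A R \<pi> \<Gamma> (f \<otimes>\<^bsub>crossed_product G A D u \<theta> \<sigma>\<^esub> f')
    = integrated_map G A R \<pi> \<Gamma> f \<otimes>\<^bsub>R\<^esub> integrated_map G A R \<pi> \<Gamma> f'"
proof -
  let ?C = "crossed_product G A D u \<theta> \<sigma>" and ?I = "integrated_map G A R \<pi> \<Gamma>"
  let ?P = "supp G A f \<times> supp G A f'"
  define m where "m p = fst p \<otimes>\<^bsub>G\<^esub> snd p" for p
  define w where "w p = \<sigma> (fst p) (snd p) \<odot>\<^bsub>A\<^esub>
      (f (fst p) \<otimes>\<^bsub>A\<^esub> \<theta> (fst p) (u (inv\<^bsub>G\<^esub> (fst p)) \<otimes>\<^bsub>A\<^esub> f' (snd p)))" for p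
  let ?S = "m ` ?P" and ?fib = "\<lambda>x. {p \<in> ?P. m p = x}"
  have mult: "f \<otimes>\<^bsub>?C\<^esub> f' = (\<lambda>x\<in>carrier G. \<Oplus>\<^bsub>A\<^esub>p\<in>?fib x. w p)"
    by (simp add: crossed_product_def m_def w_def)
  have P: "finite ?P" using finite_supp f f' by blast
  have PG: "fst p \<in> carrier G" "snd p \<in> carrier G" if "p \<in> ?P" for p
    using that by (auto simp: supp_def)
  have mc: "m p \<in> carrier G" if "p \<in> ?P" for p using PG[OF that] by (simp add: m_def)
  have wc: "w p \<in> carrier A" if "p \<in> ?P" for p
  proof -
    have "f (fst p) \<in> carrier A" and b: "f' (snd p) \<in> carrier A"
      using PG[OF that] crossed_product_component f f' D_carrier by blast+
    moreover have "u (inv\<^bsub>G\<^esub> (fst p)) \<otimes>\<^bsub>A\<^esub> f' (snd p) \<in> D (inv\<^bsub>G\<^esub> (fst p))"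
      using ideal.I_r_closed[OF ideal_D u_in_D b] PG[OF that] by simp
    then have "\<theta> (fst p) (u (inv\<^bsub>G\<^esub> (fst p)) \<otimes>\<^bsub>A\<^esub> f' (snd p)) \<in> carrier A"
      using theta_closed D_carrier PG[OF that] by blast
    ultimately show ?thesis using twist_closed PG[OF that] by (simp add: w_def)
  qed
  have tc: "\<pi> (w p) \<otimes>\<^bsub>R\<^esub> \<Gamma> (m p) \<in> carrier R" if "p \<in> ?P" for p
    using wc[OF that] mc[OF that] pi_closed Gamma_closed by simp
  have wfib: "w \<in> ?fib x \<rightarrow> carrier A" for x using wc by blast
  have "?I (f \<otimes>\<^bsub>?C\<^esub> f') = (\<Oplus>\<^bsub>R\<^esub>x\<in>?S. \<pi> ((f \<otimes>\<^bsub>?C\<^esub> f') x) \<otimes>\<^bsub>R\<^esub> \<Gamma> x)"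
  proof (rule integrated_map_eq_finsum)
    show "supp G A (f \<otimes>\<^bsub>?C\<^esub> f') \<subseteq> ?S"
    proof
      fix x assume x: "x \<in> supp G A (f \<otimes>\<^bsub>?C\<^esub> f')"
      have "?fib x \<noteq> {}"
      proof
        assume e: "?fib x = {}"
        have xG: "x \<in> carrier G" and nz: "(f \<otimes>\<^bsub>?C\<^esub> f') x \<noteq> \<zero>\<^bsub>A\<^esub>"
          using x unfolding supp_def by blast+
        have "(f \<otimes>\<^bsub>?C\<^esub> f') x = (\<Oplus>\<^bsub>A\<^esub>p\<in>?fib x. w p)"
          unfolding mult using xG by (rule restrict_apply')
        then show False using nz unfolding e by simp
      qed
      then show "x \<in> ?S" by blast
    qed
    show "f \<otimes>\<^bsub>?C\<^esub> f' \<in> carrier G \<rightarrow> carrier A"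
      unfolding mult using A.M.finsum_closed[OF wfib] by simp
  qed (use P mc in auto)
  also have "\<dots> = (\<Oplus>\<^bsub>R\<^esub>x\<in>?S. \<Oplus>\<^bsub>R\<^esub>p\<in>?fib x. \<pi> (w p) \<otimes>\<^bsub>R\<^esub> \<Gamma> (m p))"
  proof (rule T.M.finsum_cong')
    fix x assume "x \<in> ?S"
    then have x: "x \<in> carrier G" using mc by blast
    have fin: "finite (?fib x)" using P by simp
    have "\<pi> ((f \<otimes>\<^bsub>?C\<^esub> f') x) \<otimes>\<^bsub>R\<^esub> \<Gamma> x = (\<Oplus>\<^bsub>R\<^esub>p\<in>?fib x. \<pi> (w p)) \<otimes>\<^bsub>R\<^esub> \<Gamma> x"
      unfolding mult
      using x lin_map_finsum[OF A.module_axioms T.module_axioms pi_lin_map fin wfib] by simp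
    also have "\<dots> = (\<Oplus>\<^bsub>R\<^esub>p\<in>?fib x. \<pi> (w p) \<otimes>\<^bsub>R\<^esub> \<Gamma> x)"
      by (rule T.finsum_ldistr[OF fin Gamma_closed[OF x]]) (use wc pi_closed in blast)
    also have "\<dots> = (\<Oplus>\<^bsub>R\<^esub>p\<in>?fib x. \<pi> (w p) \<otimes>\<^bsub>R\<^esub> \<Gamma> (m p))"
      by (rule T.M.finsum_cong') (use tc in auto)
    finally show "\<pi> ((f \<otimes>\<^bsub>?C\<^esub> f') x) \<otimes>\<^bsub>R\<^esub> \<Gamma> x
        = (\<Oplus>\<^bsub>R\<^esub>p\<in>?fib x. \<pi> (w p) \<otimes>\<^bsub>R\<^esub> \<Gamma> (m p))" .
  qed (use tc in \<open>auto intro!: T.M.finsum_closed\<close>)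
  also have "\<dots> = (\<Oplus>\<^bsub>R\<^esub>p\<in>?P. \<pi> (w p) \<otimes>\<^bsub>R\<^esub> \<Gamma> (m p))"
    by (rule T.M.add.finprod_fibres[symmetric]) (use P tc in auto)
  also have "\<dots> = (\<Oplus>\<^bsub>R\<^esub>p\<in>?P. (\<pi> (f (fst p)) \<otimes>\<^bsub>R\<^esub> \<Gamma> (fst p))
      \<otimes>\<^bsub>R\<^esub> (\<pi> (f' (snd p)) \<otimes>\<^bsub>R\<^esub> \<Gamma> (snd p)))"
  proof (rule T.M.finsum_cong'[OF refl])
    fix p assume p: "p \<in> ?P"
    show "\<pi> (w p) \<otimes>\<^bsub>R\<^esub> \<Gamma> (m p) = (\<pi> (f (fst p)) \<otimes>\<^bsub>R\<^esub> \<Gamma> (fst p))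
        \<otimes>\<^bsub>R\<^esub> (\<pi> (f' (snd p)) \<otimes>\<^bsub>R\<^esub> \<Gamma> (snd p))"
      unfolding w_def m_def
      by (rule homogeneous_mult[symmetric]) (use PG[OF p] crossed_product_component f f' in blast)+
  next
    show "(\<lambda>p. (\<pi> (f (fst p)) \<otimes>\<^bsub>R\<^esub> \<Gamma> (fst p)) \<otimes>\<^bsub>R\<^esub> (\<pi> (f' (snd p)) \<otimes>\<^bsub>R\<^esub> \<Gamma> (snd p)))
        \<in> ?P \<rightarrow> carrier R"
    proof
      fix p assume p: "p \<in> ?P"
      have "f (fst p) \<in> carrier A" "f' (snd p) \<in> carrier A"
        using PG[OF p] crossed_product_component f f' D_carrier by blast+
      then show "(\<pi> (f (fst p)) \<otimes>\<^bsub>R\<^esub> \<Gamma> (fst p)) \<otimes>\<^bsub>R\<^esub> (\<pi> (f' (snd p)) \<otimes>\<^bsub>R\<^esub> \<Gamma> (snd p))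
          \<in> carrier R"
        using PG[OF p] pi_closed Gamma_closed by simp
    qed
  qed
  also have "\<dots> = ?I f \<otimes>\<^bsub>R\<^esub> ?I f'"
  proof -
    have "(\<lambda>g. \<pi> (e g) \<otimes>\<^bsub>R\<^esub> \<Gamma> g) \<in> supp G A e \<rightarrow> carrier R" if "e \<in> carrier ?C" for e
      using crossed_product_component[OF that] D_carrier pi_closed Gamma_closed
      by (auto simp: supp_def)
    then show ?thesis
      unfolding integrated_map_def
      using T.finsum_mult_finsum[OF finite_supp[OF f] finite_supp[OF f']] f f' by simp
  qed
  finally show ?thesis .
qed

end

theorem proposition3p10:
  fixes K :: "('k, 'm) ring_scheme"
    and G :: "('g, 'n) monoid_scheme"
    and A :: "('k, 'a, 'p) module_scheme"
    and R :: "('k, 'r, 'q) module_scheme"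
    and D :: "'g \<Rightarrow> 'a set" and u :: "'g \<Rightarrow> 'a" and \<theta> :: "'g \<Rightarrow> 'a \<Rightarrow> 'a"
    and \<sigma> :: "'g \<Rightarrow> 'g \<Rightarrow> 'k"
    and \<pi> :: "'a \<Rightarrow> 'r" and \<Gamma> :: "'g \<Rightarrow> 'r"
  assumes "field K" and "group G" and "unital_algebra K A" and "unital_algebra K R"
    and "unital_partial_action K G A D u \<theta>"
    and "twisted_unital_partial_action K G A D u \<theta> \<sigma>"
    and "covariant_sigma_rep K G A D \<theta> \<sigma> R \<pi> \<Gamma>"
  shows "(\<forall>g\<in>carrier G. \<forall>a\<in>D g.
            integrated_map G A R \<pi> \<Gamma> (delta G A a g) = \<pi> a \<otimes>\<^bsub>R\<^esub> \<Gamma> g) \<and>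
         (\<forall>\<phi>\<in>lin_map K (crossed_product G A D u \<theta> \<sigma>) R.
            (\<forall>g\<in>carrier G. \<forall>a\<in>D g. \<phi> (delta G A a g) = \<pi> a \<otimes>\<^bsub>R\<^esub> \<Gamma> g) \<longrightarrow>
            (\<forall>f\<in>carrier (crossed_product G A D u \<theta> \<sigma>). \<phi> f = integrated_map G A R \<pi> \<Gamma> f)) \<and>
         integrated_map G A R \<pi> \<Gamma> \<in> alg_hom K (crossed_product G A D u \<theta> \<sigma>) R"
proof -
  interpret covariant_sigma_representation K G A D u \<theta> \<sigma> R \<pi> \<Gamma>
    using assms(4,6,7)
    by (intro covariant_sigma_representation.intro covariant_sigma_representation_axioms.intro)
  show ?thesis
  proof (intro conjI ballI impI)
    fix \<phi> f
    assume "\<phi> \<in> lin_map K (crossed_product G A D u \<theta> \<sigma>) R"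
      and "\<forall>g\<in>carrier G. \<forall>a\<in>D g. \<phi> (delta G A a g) = \<pi> a \<otimes>\<^bsub>R\<^esub> \<Gamma> g"
      and "f \<in> carrier (crossed_product G A D u \<theta> \<sigma>)"
    then show "\<phi> f = integrated_map G A R \<pi> \<Gamma> f"
      using lin_map_eq_if_eq_on_delta[OF _ integrated_map_lin_map] integrated_map_delta by simp
  qed (use integrated_map_delta integrated_map_lin_map integrated_map_mult in
      \<open>simp_all add: alg_hom_def\<close>)
qed

end
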